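(* Let $n\ge 1$ be an integer. Then, as rational functions of $x,y$, $$P_n(x,y)=\frac{1-q^{n+1}}{1+q^{n+1}}\;\frac{y\,P_{n+1}(x)P_{n-1}(y)-x\,P_{n-1}(x)P_{n+1}(y)}{1-xy}.$$ Equivalently, for nonzero $x,y$, fixing square roots $\sqrt{-x}$ and $\sqrt{-y}$ and writing $\xi=\sqrt{-x}+(\sqrt{-x})^{-1}$, $\eta=\sqrt{-y}+(\sqrt{-y})^{-1}$, one has $$P_n(x,y)=\left(\sqrt{-x}\right)^{n-1}\left(\sqrt{-y}\right)^{n-1}(y-x)\,\tilde K^n(\xi,\eta).$$
   Context: $q$ is a generic complex parameter: $q\neq 0$ and $q$ is not a root of unity. $(a;q)_k=(1-a)(1-aq)\cdots(1-aq^{k-1})$ and $(a_1,\dots,a_r;q)_k=(a_1;q)_k\cdots(a_r;q)_k$. For integers $n\ge 0$, $m\ge1$, $$P_n(x_1,\dots,x_m)=\frac{(-q;q)_n^m}{(q;q)_n^m}\sum_{k_1,\dots,k_m=0}^n\ \prod_{1\le i<j\le m}\frac{q^{k_j}-q^{k_i}}{q^{k_j}+q^{k_i}}\prod_{i=1}^m\frac{(-q,q^{-n};q)_{k_i}}{(q,-q^{-n};q)_{k_i}}\,x_i^{k_i}.$$ In particular $P_n(x)$ and $P_n(x,y)$ are the cases $m=1$ and $m=2$. The monic polynomials $c_n$ are rescaled continuous $q$-ultraspherical polynomials, $c_n(x)=\frac{(q;q)_n}{(-q;q)_n}\,C_n(x/2;-q|q)$, that is, $$c_n(z+z^{-1})=\frac{(q;q)_n}{(-q;q)_n}\sum_{k=0}^n\frac{(-q;q)_k(-q;q)_{n-k}}{(q;q)_k(q;q)_{n-k}}\,z^{n-2k}.$$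 Put $\|c_k\|^2=\frac{(q;q)_k(q;q)_{k+1}}{(-q;q)_k(-q;q)_{k+1}}$ (for $0<q<1$ these are the squared norms of $c_k$ with respect to its suitably normalized orthogonality measure). Finally $$\tilde K^n(x,y)=\sum_{\substack{0\le k\le n-1\\ k\equiv n-1\ (\mathrm{mod}\ 2)}}\frac{c_k(x)c_k(y)}{\|c_k\|^2}.$$ *)

theory Defs
  imports Complex_Main "HOL-Computational_Algebra.Polynomial"
begin

definition qpoch :: "complex \<Rightarrow> complex \<Rightarrow> nat \<Rightarrow> complex" where
  "qpoch a q k = (\<Prod>i<k. 1 - a * q ^ i)"

text \<open>The compressed notation \<open>(a\<^sub>1,\<dots>,a\<^sub>r;q)\<^sub>k\<close>.\<close>

definition qpochs :: "complex list \<Rightarrow> complex \<Rightarrow> nat \<Rightarrow> complex" where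
  "qpochs as q k = (\<Prod>a\<leftarrow>as. qpoch a q k)"

text \<open>
  \<open>P\<^sub>n(x\<^sub>1,\<dots>,x\<^sub>m)\<close>, with the arguments given as a list of length \<open>m\<close> and the summation
  indices as a list \<open>ks\<close> of the same length; list positions are counted from 0.
\<close>

definition qP :: "complex \<Rightarrow> nat \<Rightarrow> complex list \<Rightarrow> complex" where
  "qP q n xs =
     (let m = length xs in
      qpoch (- q) q n ^ m / qpoch q q n ^ m *
      (\<Sum>ks \<in> {ks :: nat list. length ks = m \<and> set ks \<subseteq> {0..n}}.
         (\<Prod>(i, j) \<in> {(i, j). i < j \<and> j < m}.
            (q ^ (ks ! j) - q ^ (ks ! i)) / (q ^ (ks ! j) + q ^ (ks ! i))) *
         (\<Prod>i<m. qpochs [- q, q powi (- int n)] q (ks ! i) /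
                 qpochs [q, - (q powi (- int n))] q (ks ! i) * (xs ! i) ^ (ks ! i))))"

text \<open>
  The continuous \<open>q\<close>-ultraspherical (Rogers) polynomial \<open>C\<^sub>n(x;\<beta>|q)\<close>, characterised by its
  values at \<open>x = cos \<theta> = (z + z\<^sup>-\<^sup>1)/2\<close>, \<open>z = exp (\<i> \<theta>)\<close>.  Existence and uniqueness
  of the polynomial are proved below in \<open>rogers_ex1\<close>.
\<close>

definition rogers_sum :: "complex \<Rightarrow> complex \<Rightarrow> nat \<Rightarrow> complex \<Rightarrow> complex" where
  "rogers_sum \<beta> q n z =
     (\<Sum>k=0..n. qpoch \<beta> q k * qpoch \<beta> q (n - k) / (qpoch q q k * qpoch q q (n - k)) *
        z powi (int n - 2 * int k))"

definition rogers :: "complex \<Rightarrow> complex \<Rightarrow> nat \<Rightarrow> complex poly" where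
  "rogers \<beta> q n = (THE p. \<forall>z. z \<noteq> 0 \<longrightarrow> poly p ((z + inverse z) / 2) = rogers_sum \<beta> q n z)"

definition cpoly :: "complex \<Rightarrow> nat \<Rightarrow> complex \<Rightarrow> complex" where
  "cpoly q n x = qpoch q q n / qpoch (- q) q n * poly (rogers (- q) q n) (x / 2)"

definition cpoly_norm_sq :: "complex \<Rightarrow> nat \<Rightarrow> complex" where
  "cpoly_norm_sq q k =
     qpoch q q k * qpoch q q (k + 1) / (qpoch (- q) q k * qpoch (- q) q (k + 1))"

definition K_tilde :: "complex \<Rightarrow> nat \<Rightarrow> complex \<Rightarrow> complex \<Rightarrow> complex" where
  "K_tilde q n x y =
     (\<Sum>k \<in> {k. k \<le> n - 1 \<and> k mod 2 = (n - 1) mod 2}. cpoly q k x * cpoly q k y / cpoly_norm_sq q k)"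

lemma power_sum_poly_ex:
  "\<exists>p :: complex poly. \<forall>z. z \<noteq> 0 \<longrightarrow> poly p ((z + inverse z) / 2) = z ^ j + inverse z ^ j"
proof (induction j rule: less_induct)
  case (less j)
  consider "j = 0" | "j = 1" | i where "j = Suc (Suc i)"
    by (metis One_nat_def not0_implies_Suc)
  then show ?case
  proof cases
    case 1
    then show ?thesis by (intro exI[of _ "[:2:]"]) auto
  next
    case 2
    then show ?thesis by (intro exI[of _ "[:0, 2:]"]) auto
  next
    case 3
    obtain p :: "complex poly" where p: "\<And>z. z \<noteq> 0 \<Longrightarrow> poly p ((z + inverse z) / 2) = z ^ Suc i + inverse z ^ Suc i"
      using less.IH[of "Suc i"] 3 by auto
    obtain r :: "complex poly" where r: "\<And>z. z \<noteq> 0 \<Longrightarrow> poly r ((z + inverse z) / 2) = z ^ i + inverse z ^ i"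
      using less.IH[of i] 3 by auto
    have "poly ([:0, 2:] * p - r) ((z + inverse z) / 2) = z ^ j + inverse z ^ j" if "z \<noteq> 0" for z
    proof -
      have "poly ([:0, 2:] * p - r) ((z + inverse z) / 2)
          = (z + inverse z) * (z ^ Suc i + inverse z ^ Suc i) - (z ^ i + inverse z ^ i)"
        using that by (simp add: p r)
      also have "\<dots> = z ^ j + inverse z ^ j + (z * inverse z - 1) * (z ^ i + inverse z ^ i)"
        unfolding 3 power_Suc by (simp add: algebra_simps)
      finally show ?thesis using that by simp
    qed
    then show ?thesis by blast
  qed
qed

lemma powi_sum_poly_ex:
  "\<exists>p :: complex poly. \<forall>z. z \<noteq> 0 \<longrightarrow> poly p ((z + inverse z) / 2) = z powi a + z powi (- a)"
proof -
  obtain p :: "complex poly" where p: "\<And>z. z \<noteq> 0 \<Longrightarrow>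
      poly p ((z + inverse z) / 2) = z ^ nat \<bar>a\<bar> + inverse z ^ nat \<bar>a\<bar>"
    using power_sum_poly_ex by blast
  have "z ^ nat \<bar>a\<bar> + inverse z ^ nat \<bar>a\<bar> = z powi a + z powi (- a)" for z :: complex
    by (cases a rule: int_cases2) (simp_all add: power_int_minus power_inverse)
  with p have "\<forall>z. z \<noteq> 0 \<longrightarrow> poly p ((z + inverse z) / 2) = z powi a + z powi (- a)"
    by simp
  then show ?thesis by (rule exI)
qed

lemma rogers_sum_symmetric:
  "rogers_sum \<beta> q n z =
     (\<Sum>k=0..n. qpoch \<beta> q k * qpoch \<beta> q (n - k) / (qpoch q q k * qpoch q q (n - k)) / 2 *
        (z powi (int n - 2 * int k) + z powi (- (int n - 2 * int k))))"
proof -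
  let ?g = "\<lambda>k. qpoch \<beta> q k * qpoch \<beta> q (n - k) / (qpoch q q k * qpoch q q (n - k))"
  have "rogers_sum \<beta> q n z = (\<Sum>k=0..n. ?g (n - k) * z powi (int n - 2 * int (n - k)))"
    unfolding rogers_sum_def by (subst sum.atLeastAtMost_rev) simp
  also have "\<dots> = (\<Sum>k=0..n. ?g k * z powi (- (int n - 2 * int k)))"
    by (intro sum.cong refl) (auto simp: of_nat_diff mult.commute)
  finally have 2: "rogers_sum \<beta> q n z = (\<Sum>k=0..n. ?g k * z powi (- (int n - 2 * int k)))" .
  have "rogers_sum \<beta> q n z = (rogers_sum \<beta> q n z + rogers_sum \<beta> q n z) / 2" by simp
  also have "\<dots> = ((\<Sum>k=0..n. ?g k * z powi (int n - 2 * int k)) +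
      (\<Sum>k=0..n. ?g k * z powi (- (int n - 2 * int k)))) / 2"
    by (subst (2) 2) (simp only: rogers_sum_def)
  also have "\<dots> = (\<Sum>k=0..n. ?g k / 2 * (z powi (int n - 2 * int k) + z powi (- (int n - 2 * int k))))"
    unfolding sum.distrib[symmetric] sum_divide_distrib
    by (intro sum.cong refl) (simp add: distrib_left add_divide_distrib)
  finally show ?thesis .
qed

lemma joukowski_surj: "\<exists>z :: complex. z \<noteq> 0 \<and> (z + inverse z) / 2 = w"
proof -
  define s where "s = csqrt (w\<^sup>2 - 1)"
  have s: "s\<^sup>2 = w\<^sup>2 - 1" by (simp add: s_def)
  have 1: "(w + s) * (w - s) = 1"
    using s by (simp add: algebra_simps power2_eq_square)
  then have "inverse (w + s) = w - s" by (rule inverse_unique)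
  with 1 show ?thesis by (intro exI[of _ "w + s"]) auto
qed

lemma rogers_ex1:
  "\<exists>!p. \<forall>z. z \<noteq> 0 \<longrightarrow> poly p ((z + inverse z) / 2) = rogers_sum \<beta> q n z"
proof (rule ex_ex1I)
  have "\<forall>a. \<exists>p :: complex poly. \<forall>z. z \<noteq> 0 \<longrightarrow>
      poly p ((z + inverse z) / 2) = z powi a + z powi (- a)"
    using powi_sum_poly_ex by blast
  then obtain D :: "int \<Rightarrow> complex poly" where
    D: "\<And>a z. z \<noteq> 0 \<Longrightarrow> poly (D a) ((z + inverse z) / 2) = z powi a + z powi (- a)"
    by metis
  let ?p = "\<Sum>k=0..n. smult (qpoch \<beta> q k * qpoch \<beta> q (n - k) / (qpoch q q k * qpoch q q (n - k)) / 2)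
              (D (int n - 2 * int k))"
  have "\<forall>z. z \<noteq> 0 \<longrightarrow> poly ?p ((z + inverse z) / 2) = rogers_sum \<beta> q n z"
    unfolding rogers_sum_symmetric poly_sum poly_smult using D by simp
  then show "\<exists>p. \<forall>z. z \<noteq> 0 \<longrightarrow> poly p ((z + inverse z) / 2) = rogers_sum \<beta> q n z" by blast
next
  fix p r
  assume "\<forall>z. z \<noteq> 0 \<longrightarrow> poly p ((z + inverse z) / 2) = rogers_sum \<beta> q n z"
    and "\<forall>z. z \<noteq> 0 \<longrightarrow> poly r ((z + inverse z) / 2) = rogers_sum \<beta> q n z"
  then have "poly p w = poly r w" for w using joukowski_surj[of w] by metis
  then show "p = r" using poly_eq_poly_eq_iff by blast
qed

lemma cpoly_joukowski:
  assumes "z \<noteq> 0"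
  shows "cpoly q n (z + inverse z) = qpoch q q n / qpoch (- q) q n *
     (\<Sum>k=0..n. qpoch (- q) q k * qpoch (- q) q (n - k) / (qpoch q q k * qpoch q q (n - k)) *
        z powi (int n - 2 * int k))"
  using theI'[OF rogers_ex1[of "- q" q n]] assms
  unfolding cpoly_def rogers_def rogers_sum_def by simp

end

theory Submission
  imports Defs
begin

text \<open>
  Write \<open>A k = (-q;q)\<^sub>k / (q;q)\<^sub>k\<close>, \<open>X = -x\<close>, \<open>Y = -y\<close>. Reversing the factors of the
  shifted factorials with base \<open>\<plusminus>q\<^sup>-\<^sup>n\<close> turns \<open>P\<^sub>n(x)\<close> into the self-convolution
  \<open>p\<^sub>n(X) = \<Sum>k\<le>n. A k * A (n-k) * X^k\<close>, and \<open>P\<^sub>n(x,y)\<close> into the double sum \<open>D\<^sub>n(X,Y)\<close>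
  over the terms of \<open>p\<^sub>n(X) * p\<^sub>n(Y)\<close> weighted by \<open>(q^l - q^k) / (q^l + q^k)\<close>.

  The sequence \<open>A\<close> satisfies \<open>A k - A (k-1) = q^k * (A k + A (k-1))\<close>, where \<open>A (-1) = 0\<close>.
  In other words, the ratio \<open>(f - g) / (f + g)\<close> of two neighbours is a power of \<open>q\<close>. For two such
  pairs, with ratios \<open>u\<close> and \<open>v\<close>, the weight \<open>(v - u) / (v + u)\<close> turns
  \<open>f * f' - g * g'\<close> into \<open>f' * g - f * g'\<close>, which has separated variables. Lowering the first
  index of each \<open>A k * A (n-k)\<close>, or lowering the second, therefore relates \<open>D\<^sub>n\<close> to \<open>D\<^sub>n\<^sub>-\<^sub>1\<close> in
  two ways (\<open>weighted_lower_first\<close>, \<open>weighted_lower_second\<close>):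
  \<open>D\<^sub>n = X Y D\<^sub>n\<^sub>-\<^sub>1 + X p\<^sub>n\<^sub>-\<^sub>1(X) p\<^sub>n(Y) - Y p\<^sub>n(X) p\<^sub>n\<^sub>-\<^sub>1(Y)\<close> and
  \<open>D\<^sub>n = D\<^sub>n\<^sub>-\<^sub>1 + p\<^sub>n(X) p\<^sub>n\<^sub>-\<^sub>1(Y) - p\<^sub>n\<^sub>-\<^sub>1(X) p\<^sub>n(Y)\<close>.

  Eliminating \<open>D\<^sub>n\<^sub>-\<^sub>1\<close> expresses \<open>(1 - X Y) D\<^sub>n\<close> through \<open>p\<^sub>n\<close> and \<open>p\<^sub>n\<^sub>-\<^sub>1\<close>, and the three-term
  recurrence of the polynomials \<open>p\<^sub>n\<close> (\<open>conv_three_term\<close>) brings this into the first form of the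
  result. Using the first relation at \<open>n\<close> and the second at \<open>n-1\<close> gives instead
  \<open>D\<^sub>n - X Y D\<^sub>n\<^sub>-\<^sub>2 = (X - Y) p\<^sub>n\<^sub>-\<^sub>1(X) p\<^sub>n\<^sub>-\<^sub>1(Y) A n / A (n-1)\<close>, whose iteration is the sum over
  every second degree that occurs in the kernel. This second derivation does not divide by
  \<open>1 - X Y\<close>, so it also covers the points with \<open>x y = 1\<close>.
\<close>

section \<open>Neighbouring pairs\<close>

text \<open>
  With \<open>u = e^(2s)\<close>, \<open>f : g\<close> is \<open>cosh s : - sinh s\<close>, and the two lemmas are addition theorems.
  Not dividing by \<open>f\<close> or \<open>g\<close> keeps them valid when \<open>g = 0\<close>, which is what happens
  at the ends of the summation ranges.
\<close>

lemma weighted_pair_exchange: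
  fixes f g f' g' u v :: complex
  assumes "f - g = u * (f + g)" "f' - g' = v * (f' + g')" "v + u \<noteq> 0"
  shows "(v - u) / (v + u) * (f * f') = (v - u) / (v + u) * (g * g') + (f' * g - f * g')"
proof -
  have sum: "2 * (f * f' - g * g') = (v + u) * ((f + g) * (f' + g'))"
  proof -
    have "2 * (f * f' - g * g') = (f + g) * (f' - g') + (f - g) * (f' + g')"
      by (simp add: algebra_simps)
    then show ?thesis by (simp only: assms(1,2)) (simp add: algebra_simps)
  qed
  have diff: "2 * (f' * g - f * g') = (v - u) * ((f + g) * (f' + g'))"
  proof -
    have "2 * (f' * g - f * g') = (f + g) * (f' - g') - (f - g) * (f' + g')"
      by (simp add: algebra_simps)
    then show ?thesis by (simp only: assms(1,2)) (simp add: algebra_simps)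
  qed
  let ?S = "(f + g) * (f' + g') / 2"
  have "f * f' - g * g' = (v + u) * ?S" "f' * g - f * g' = (v - u) * ?S"
    using sum diff by (simp_all add: field_simps)
  then have "(v - u) / (v + u) * (f * f' - g * g') = f' * g - f * g'"
    using assms(3) by (simp del: times_divide_eq_right)
  then show ?thesis by (simp only: right_diff_distrib diff_eq_eq add.commute)
qed

lemma pair_addition:
  fixes f g f' g' u v :: complex
  assumes "f - g = u * (f + g)" "f' - g' = v * (f' + g')"
  shows "(1 + u * v) * (f * g' + g * f') = (1 - u * v) * (f * f' + g * g')"
proof -
  have "2 * (f * f' + g * g') = (f + g) * (f' + g') + (f - g) * (f' - g')"
    by (simp add: algebra_simps)
  also have "\<dots> = (1 + u * v) * ((f + g) * (f' + g'))"
    by (simp only: assms) (simp add: algebra_simps)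
  finally have sum: "2 * (f * f' + g * g') = (1 + u * v) * ((f + g) * (f' + g'))" .
  have "2 * (f * g' + g * f') = (f + g) * (f' + g') - (f - g) * (f' - g')"
    by (simp add: algebra_simps)
  also have "\<dots> = (1 - u * v) * ((f + g) * (f' + g'))"
    by (simp only: assms) (simp add: algebra_simps)
  finally have diff: "2 * (f * g' + g * f') = (1 - u * v) * ((f + g) * (f' + g'))" .
  have "2 * ((1 + u * v) * (f * g' + g * f')) = (1 + u * v) * (2 * (f * g' + g * f'))"
    by simp
  also have "\<dots> = (1 - u * v) * (2 * (f * f' + g * g'))"
    unfolding sum diff by simp
  also have "\<dots> = 2 * ((1 - u * v) * (f * f' + g * g'))"
    by (rule mult.left_commute)
  finally show ?thesis by (simp only: mult_cancel_left zero_neq_numeral[symmetric] simp_thms)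
qed

section \<open>Self-convolutions and their weighted products\<close>

locale generic_base =
  fixes q :: complex
  assumes q_nonzero: "q \<noteq> 0"
    and q_power_neq_1: "\<And>k::nat. k \<ge> 1 \<Longrightarrow> q ^ k \<noteq> 1"
begin

lemma one_plus_q_power_nonzero: "1 + q ^ k \<noteq> 0"
proof
  assume "1 + q ^ k = 0"
  then have eq: "q ^ k = -1" by (simp add: add_eq_0_iff)
  then have "q ^ (2 * k) = 1" by (simp add: power_mult mult.commute[of 2])
  moreover have "k \<ge> 1" using eq by (cases k) auto
  ultimately show False using q_power_neq_1[of "2 * k"] by simp
qed

lemma q_power_add_nonzero: "q ^ k + q ^ l \<noteq> 0"
proof -
  have *: "q ^ i + q ^ (i + d) \<noteq> 0" for i d
  proof -
    have "q ^ i + q ^ (i + d) = q ^ i * (1 + q ^ d)" by (simp add: power_add algebra_simps)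
    then show ?thesis using q_nonzero one_plus_q_power_nonzero by simp
  qed
  show ?thesis
  proof (cases "k \<le> l")
    case True
    then show ?thesis using *[of k "l - k"] by simp
  next
    case False
    then show ?thesis using *[of l "k - l"] by (simp add: add.commute)
  qed
qed

lemma qpoch_nonzero: "qpoch q q k \<noteq> 0" "qpoch (- q) q k \<noteq> 0"
  using q_power_neq_1[of "Suc i" for i] one_plus_q_power_nonzero[of "Suc i" for i]
  by (auto simp: qpoch_def)

definition A :: "nat \<Rightarrow> complex" where
  "A k = qpoch (- q) q k / qpoch q q k"

text \<open>
  The value \<open>0\<close> at \<open>0\<close> makes \<open>A_pair\<close> hold for every index, so that all relations between
  coefficients include the ends of the summation ranges.
\<close>

definition A_prev :: "nat \<Rightarrow> complex" where
  "A_prev k = (case k of 0 \<Rightarrow> 0 | Suc j \<Rightarrow> A j)"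

lemma A_prev_simps [simp]: "A_prev 0 = 0" "A_prev (Suc j) = A j"
  by (simp_all add: A_prev_def)

lemma A_0 [simp]: "A 0 = 1"
  by (simp add: A_def qpoch_def)

lemma A_nonzero [simp]: "A k \<noteq> 0"
  by (simp add: A_def qpoch_nonzero)

lemma A_Suc: "A (Suc k) = A k * ((1 + q ^ Suc k) / (1 - q ^ Suc k))"
  by (simp add: A_def qpoch_def)

lemma A_pair: "A k - A_prev k = q ^ k * (A k + A_prev k)"
proof (cases k)
  case (Suc j)
  have "1 - q ^ Suc j \<noteq> 0" using q_power_neq_1[of "Suc j"] by simp
  then have "A (Suc j) * (1 - q ^ Suc j) = A j * (1 + q ^ Suc j)"
    unfolding A_Suc by simp
  then show ?thesis using Suc by (simp add: algebra_simps)
qed simp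

definition conv :: "nat \<Rightarrow> complex \<Rightarrow> complex" where
  "conv n X = (\<Sum>k\<le>n. A k * A (n - k) * X ^ k)"

definition weighted_conv :: "nat \<Rightarrow> complex \<Rightarrow> complex \<Rightarrow> complex" where
  "weighted_conv n X Y = (\<Sum>k\<le>n. \<Sum>l\<le>n. (q ^ l - q ^ k) / (q ^ l + q ^ k) *
     ((A k * A (n - k)) * (A l * A (n - l))) * X ^ k * Y ^ l)"

lemma conv_lower_first: "(\<Sum>k\<le>Suc m. A_prev k * A (Suc m - k) * X ^ k) = X * conv m X"
  by (subst sum.atMost_Suc_shift) (simp add: conv_def sum_distrib_left mult_ac)

lemma conv_lower_second: "(\<Sum>k\<le>Suc m. A k * A_prev (Suc m - k) * X ^ k) = conv m X"
  by (simp add: conv_def Suc_diff_le)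

lemma conv_lower_both:
  "(\<Sum>k\<le>Suc (Suc m). A_prev k * A_prev (Suc (Suc m) - k) * X ^ k) = X * conv m X"
  by (subst sum.atMost_Suc_shift) (simp add: conv_def Suc_diff_le sum_distrib_left mult_ac)

text \<open>
  The two powers of \<open>q\<close> belonging to \<open>A k\<close> and \<open>A (m + 2 - k)\<close> multiply to
  \<open>q ^ (m + 2)\<close>, independently of \<open>k\<close>, so the addition lemma applies to all coefficients
  with the same factor.
\<close>

lemma conv_three_term:
  "(1 + q ^ Suc (Suc m)) * ((1 + X) * conv (Suc m) X)
   = (1 - q ^ Suc (Suc m)) * (conv (Suc (Suc m)) X + X * conv m X)"
proof -
  let ?N = "Suc (Suc m)"
  have "(1 + q ^ ?N) * ((1 + X) * conv (Suc m) X)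
      = (1 + q ^ ?N) * ((\<Sum>k\<le>?N. A k * A_prev (?N - k) * X ^ k) + (\<Sum>k\<le>?N. A_prev k * A (?N - k) * X ^ k))"
    unfolding conv_lower_first conv_lower_second by (simp add: algebra_simps)
  also have "\<dots> = (\<Sum>k\<le>?N. (1 + q ^ ?N) * (A k * A_prev (?N - k) + A_prev k * A (?N - k)) * X ^ k)"
    by (simp only: sum.distrib[symmetric] sum_distrib_left) (simp add: algebra_simps)
  also have "\<dots> = (\<Sum>k\<le>?N. (1 - q ^ ?N) * (A k * A (?N - k) + A_prev k * A_prev (?N - k)) * X ^ k)"
  proof (rule sum.cong[OF refl])
    fix k assume "k \<in> {..?N}"
    then have "q ^ k * q ^ (?N - k) = q ^ ?N" by (simp flip: power_add)
    then show "(1 + q ^ ?N) * (A k * A_prev (?N - k) + A_prev k * A (?N - k)) * X ^ k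
        = (1 - q ^ ?N) * (A k * A (?N - k) + A_prev k * A_prev (?N - k)) * X ^ k"
      using pair_addition[OF A_pair[of k] A_pair[of "?N - k"]] by simp
  qed
  also have "\<dots> = (1 - q ^ ?N) * ((\<Sum>k\<le>?N. A k * A (?N - k) * X ^ k)
      + (\<Sum>k\<le>?N. A_prev k * A_prev (?N - k) * X ^ k))"
    by (simp only: sum.distrib[symmetric] sum_distrib_left) (simp add: algebra_simps)
  also have "\<dots> = (1 - q ^ ?N) * (conv ?N X + X * conv m X)"
    unfolding conv_lower_both by (simp add: conv_def)
  finally show ?thesis .
qed

lemma conv_three_term_A:
  "A (Suc (Suc m)) / A (Suc m) * ((1 + X) * conv (Suc m) X) = conv (Suc (Suc m)) X + X * conv m X"
proof -
  have "1 - q ^ Suc (Suc m) \<noteq> 0" using q_power_neq_1[of "Suc (Suc m)"] by simp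
  then show ?thesis
    using conv_three_term[of m X] unfolding A_Suc[of "Suc m"]
    by (simp add: nonzero_eq_divide_eq nonzero_divide_eq_eq mult_ac del: power_Suc)
qed

lemma double_sum_separated:
  fixes f g :: "nat \<Rightarrow> complex"
  shows "(\<Sum>k\<le>n. \<Sum>l\<le>n. (f l * g k - f k * g l) * X ^ k * Y ^ l)
   = (\<Sum>k\<le>n. g k * X ^ k) * (\<Sum>l\<le>n. f l * Y ^ l) - (\<Sum>k\<le>n. f k * X ^ k) * (\<Sum>l\<le>n. g l * Y ^ l)"
  by (simp only: sum_product sum_subtractf[symmetric]) (simp add: algebra_simps)

text \<open>
  The weight depends on \<open>l - k\<close> alone, so the double sum over the lowered coefficients is
  \<open>weighted_conv m\<close> up to the shift of both indices.
\<close>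

lemma weighted_lower_first:
  "weighted_conv (Suc m) X Y = X * Y * weighted_conv m X Y
     + X * conv m X * conv (Suc m) Y - Y * conv (Suc m) X * conv m Y"
proof -
  let ?w = "\<lambda>k l. (q ^ l - q ^ k) / (q ^ l + q ^ k)"
  let ?n = "Suc m"
  let ?f = "\<lambda>k. A k * A (?n - k)"
  let ?g = "\<lambda>k. A_prev k * A (?n - k)"
  have pair: "?f k - ?g k = q ^ k * (?f k + ?g k)" for k
    by (simp only: A_pair left_diff_distrib[symmetric] distrib_right[symmetric] mult.assoc)
  have shift: "?w (Suc k) (Suc l) = ?w k l" for k l
  proof -
    have "?w (Suc k) (Suc l) = (q * (q ^ l - q ^ k)) / (q * (q ^ l + q ^ k))"
      by (simp add: algebra_simps)
    then show ?thesis using q_nonzero by simp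
  qed
  have "weighted_conv ?n X Y = (\<Sum>k\<le>?n. \<Sum>l\<le>?n. ?w k l * (?g k * ?g l) * X ^ k * Y ^ l)
      + (\<Sum>k\<le>?n. \<Sum>l\<le>?n. (?f l * ?g k - ?f k * ?g l) * X ^ k * Y ^ l)"
    unfolding weighted_conv_def
    by (simp only: weighted_pair_exchange[OF pair pair q_power_add_nonzero] distrib_right sum.distrib)
  also have "(\<Sum>k\<le>?n. \<Sum>l\<le>?n. ?w k l * (?g k * ?g l) * X ^ k * Y ^ l)
      = (\<Sum>k\<le>m. \<Sum>l\<le>m. ?w (Suc k) (Suc l) * ((A k * A (m - k)) * (A l * A (m - l))) * X ^ Suc k * Y ^ Suc l)"
    by (simp only: sum.atMost_Suc_shift A_prev_simps) simp
  also have "\<dots> = X * Y * weighted_conv m X Y"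
    unfolding shift weighted_conv_def by (simp add: sum_distrib_left mult_ac)
  finally show ?thesis
    unfolding double_sum_separated conv_lower_first by (simp add: conv_def mult_ac)
qed

text \<open>
  Lowering the second index involves the powers \<open>q ^ (n - k)\<close>, for which the weight changes sign.
\<close>

lemma weighted_lower_second:
  "weighted_conv (Suc m) X Y = weighted_conv m X Y
     + conv (Suc m) X * conv m Y - conv m X * conv (Suc m) Y"
proof -
  let ?w = "\<lambda>k l. (q ^ l - q ^ k) / (q ^ l + q ^ k)"
  let ?n = "Suc m"
  let ?f = "\<lambda>k. A k * A (?n - k)"
  let ?g = "\<lambda>k. A k * A_prev (?n - k)"
  have pair: "?f k - ?g k = q ^ (?n - k) * (?f k + ?g k)" for k
    by (simp only: A_pair right_diff_distrib[symmetric] distrib_left[symmetric] mult.left_commute)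
  have reflect: "?w (?n - k) (?n - l) = - ?w k l" if "k \<le> ?n" "l \<le> ?n" for k l
  proof -
    have "q ^ (?n - k) = q ^ ?n / q ^ k" "q ^ (?n - l) = q ^ ?n / q ^ l"
      using that q_nonzero by (simp_all add: power_diff)
    then have "?w (?n - k) (?n - l) = (q ^ ?n / q ^ l - q ^ ?n / q ^ k) / (q ^ ?n / q ^ l + q ^ ?n / q ^ k)"
      by simp
    also have "q ^ ?n / q ^ l - q ^ ?n / q ^ k = (q ^ ?n / (q ^ l * q ^ k)) * - (q ^ l - q ^ k)"
      using q_nonzero by (simp add: field_simps)
    also have "q ^ ?n / q ^ l + q ^ ?n / q ^ k = (q ^ ?n / (q ^ l * q ^ k)) * (q ^ l + q ^ k)"
      using q_nonzero by (simp add: field_simps)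
    also have "q ^ ?n / (q ^ l * q ^ k) * - (q ^ l - q ^ k) / (q ^ ?n / (q ^ l * q ^ k) * (q ^ l + q ^ k))
        = - (q ^ l - q ^ k) / (q ^ l + q ^ k)"
      using q_nonzero by (intro mult_divide_mult_cancel_left) simp
    finally show ?thesis by (simp only: minus_divide_left)
  qed
  have exchange: "?w k l * (?f k * ?f l) = ?w k l * (?g k * ?g l) - (?f l * ?g k - ?f k * ?g l)"
    if "k \<le> ?n" "l \<le> ?n" for k l
    using weighted_pair_exchange[OF pair[of k] pair[of l] q_power_add_nonzero]
    unfolding reflect[OF that] by (simp add: algebra_simps)
  have "weighted_conv ?n X Y
      = (\<Sum>k\<le>?n. \<Sum>l\<le>?n. (?w k l * (?g k * ?g l) - (?f l * ?g k - ?f k * ?g l)) * X ^ k * Y ^ l)"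
    unfolding weighted_conv_def
    by (intro sum.cong refl) (simp only: exchange atMost_iff)
  also have "\<dots> = (\<Sum>k\<le>?n. \<Sum>l\<le>?n. ?w k l * (?g k * ?g l) * X ^ k * Y ^ l)
      - (\<Sum>k\<le>?n. \<Sum>l\<le>?n. (?f l * ?g k - ?f k * ?g l) * X ^ k * Y ^ l)"
    by (simp only: left_diff_distrib sum_subtractf)
  also have "(\<Sum>k\<le>?n. \<Sum>l\<le>?n. ?w k l * (?g k * ?g l) * X ^ k * Y ^ l) = weighted_conv m X Y"
    by (simp add: weighted_conv_def Suc_diff_le)
  finally show ?thesis
    unfolding double_sum_separated conv_lower_second by (simp add: conv_def mult_ac)
qed

section \<open>The two closed forms of the weighted sum\<close>

text \<open>
  Subtracting \<open>X * Y\<close> times the second relation from the first cancels \<open>weighted_conv m\<close>;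
  the factors \<open>1 + X\<close> and \<open>1 + Y\<close> that remain are those of the three-term recurrence.
\<close>

lemma weighted_conv_closed_form:
  "(1 - X * Y) * weighted_conv (Suc m) X Y
   = (1 - q ^ Suc (Suc m)) / (1 + q ^ Suc (Suc m)) *
     (X * conv m X * conv (Suc (Suc m)) Y - Y * conv (Suc (Suc m)) X * conv m Y)"
proof -
  have *: "(1 + Z) * conv (Suc m) Z
      = (1 - q ^ Suc (Suc m)) / (1 + q ^ Suc (Suc m)) * (conv (Suc (Suc m)) Z + Z * conv m Z)" for Z
    using conv_three_term[of m Z] one_plus_q_power_nonzero[of "Suc (Suc m)"]
    by (simp add: nonzero_eq_divide_eq mult_ac del: power_Suc)
  have "(1 - X * Y) * weighted_conv (Suc m) X Y
      = weighted_conv (Suc m) X Y - X * Y * weighted_conv (Suc m) X Y"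
    by (simp add: algebra_simps)
  also have "\<dots> = (X * Y * weighted_conv m X Y
        + X * conv m X * conv (Suc m) Y - Y * conv (Suc m) X * conv m Y)
      - X * Y * (weighted_conv m X Y
        + conv (Suc m) X * conv m Y - conv m X * conv (Suc m) Y)"
    by (subst weighted_lower_first, subst weighted_lower_second) (rule refl)
  also have "\<dots> = X * conv m X * ((1 + Y) * conv (Suc m) Y) - Y * conv m Y * ((1 + X) * conv (Suc m) X)"
    by (simp add: algebra_simps)
  also have "\<dots> = (1 - q ^ Suc (Suc m)) / (1 + q ^ Suc (Suc m)) *
      (X * conv m X * (conv (Suc (Suc m)) Y + Y * conv m Y)
       - Y * conv m Y * (conv (Suc (Suc m)) X + X * conv m X))"
    unfolding * by (simp only: right_diff_distrib mult_ac)
  finally show ?thesis by (simp add: algebra_simps)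
qed

text \<open>
  Here the three-term recurrence is read backwards: the terms of degree \<open>m\<close> and \<open>m + 2\<close> in one
  variable combine into a multiple of \<open>conv (m + 1)\<close>, and
  \<open>X * (1 + Y) - Y * (1 + X) = X - Y\<close>.
\<close>

lemma weighted_conv_step:
  "weighted_conv (Suc (Suc m)) X Y = X * Y * weighted_conv m X Y
     + (X - Y) * (A (Suc (Suc m)) / A (Suc m)) * conv (Suc m) X * conv (Suc m) Y"
proof -
  let ?r = "A (Suc (Suc m)) / A (Suc m)"
  have "weighted_conv (Suc (Suc m)) X Y = X * Y * weighted_conv m X Y
      + X * conv (Suc m) X * (conv (Suc (Suc m)) Y + Y * conv m Y)
      - Y * conv (Suc m) Y * (conv (Suc (Suc m)) X + X * conv m X)"
    unfolding weighted_lower_first[of "Suc m"] weighted_lower_second[of m]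
    by (simp add: algebra_simps)
  also have "\<dots> = X * Y * weighted_conv m X Y
      + X * conv (Suc m) X * (?r * ((1 + Y) * conv (Suc m) Y))
      - Y * conv (Suc m) Y * (?r * ((1 + X) * conv (Suc m) X))"
    unfolding conv_three_term_A ..
  also have "\<dots> = X * Y * weighted_conv m X Y + (X - Y) * ?r * conv (Suc m) X * conv (Suc m) Y"
    by (simp only: algebra_simps mult_1_left)
  finally show ?thesis .
qed

text \<open>
  The index set is \<open>{n-1, n-3, \<dots>}\<close>; writing it this way makes it empty for \<open>n = 0\<close>, so that the
  two-step induction starts at \<open>0\<close> and \<open>1\<close>. The powers of \<open>s * t\<close>, with \<open>s\<^sup>2 = X\<close> and \<open>t\<^sup>2 = Y\<close>,
  collect the factors \<open>X * Y\<close> of the iterated step.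
\<close>

lemma weighted_conv_kernel_sum:
  "weighted_conv n (s\<^sup>2) (t\<^sup>2) = (s\<^sup>2 - t\<^sup>2) * (\<Sum>k | k < n \<and> odd (n + k).
     (s * t) ^ (n - 1 - k) * (A (Suc k) / A k) * conv k (s\<^sup>2) * conv k (t\<^sup>2))"
proof (induction n rule: nat_induct2)
  case 0
  show ?case by (simp add: weighted_conv_def)
next
  case 1
  have set: "{k. k < (1::nat) \<and> odd (1 + k)} = {0}" by auto
  have "weighted_conv 0 (s\<^sup>2) (t\<^sup>2) = 0" by (simp add: weighted_conv_def)
  then have "weighted_conv 1 (s\<^sup>2) (t\<^sup>2) = (s\<^sup>2 - t\<^sup>2) * A 1"
    using weighted_lower_first[of 0 "s\<^sup>2" "t\<^sup>2"] by (simp add: conv_def algebra_simps)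
  then show ?case unfolding set by (simp add: conv_def)
next
  case (step n)
  let ?T = "\<lambda>k. (A (Suc k) / A k) * conv k (s\<^sup>2) * conv k (t\<^sup>2)"
  have set: "{k. k < n + 2 \<and> odd (n + 2 + k)} = insert (Suc n) {k. k < n \<and> odd (n + k)}"
  proof (rule set_eqI)
    fix k
    show "k \<in> {k. k < n + 2 \<and> odd (n + 2 + k)} \<longleftrightarrow> k \<in> insert (Suc n) {k. k < n \<and> odd (n + k)}"
      by (cases "k = n"; cases "k = Suc n") auto
  qed
  have "(\<Sum>k | k < n + 2 \<and> odd (n + 2 + k). (s * t) ^ (n + 2 - 1 - k) * ?T k)
      = ?T (Suc n) + (\<Sum>k | k < n \<and> odd (n + k). (s * t) ^ (n + 2 - 1 - k) * ?T k)"
    unfolding set by simp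
  also have "(\<Sum>k | k < n \<and> odd (n + k). (s * t) ^ (n + 2 - 1 - k) * ?T k)
      = (\<Sum>k | k < n \<and> odd (n + k). (s\<^sup>2 * t\<^sup>2) * ((s * t) ^ (n - 1 - k) * ?T k))"
  proof (rule sum.cong[OF refl])
    fix k assume "k \<in> {k. k < n \<and> odd (n + k)}"
    then have "n + 2 - 1 - k = (n - 1 - k) + 2" by auto
    then show "(s * t) ^ (n + 2 - 1 - k) * ?T k = (s\<^sup>2 * t\<^sup>2) * ((s * t) ^ (n - 1 - k) * ?T k)"
      by (simp only: power_add) (simp add: power_mult_distrib)
  qed
  finally have sum: "(\<Sum>k | k < n + 2 \<and> odd (n + 2 + k). (s * t) ^ (n + 2 - 1 - k) * ?T k)
      = ?T (Suc n) + (s\<^sup>2 * t\<^sup>2) * (\<Sum>k | k < n \<and> odd (n + k). (s * t) ^ (n - 1 - k) * ?T k)"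
    by (simp only: sum_distrib_left)
  have IH: "weighted_conv n (s\<^sup>2) (t\<^sup>2)
      = (s\<^sup>2 - t\<^sup>2) * (\<Sum>k | k < n \<and> odd (n + k). (s * t) ^ (n - 1 - k) * ?T k)"
    using step by (simp only: mult.assoc)
  have "weighted_conv (n + 2) (s\<^sup>2) (t\<^sup>2) = s\<^sup>2 * t\<^sup>2 * weighted_conv n (s\<^sup>2) (t\<^sup>2) + (s\<^sup>2 - t\<^sup>2) * ?T (Suc n)"
    using weighted_conv_step[of n "s\<^sup>2" "t\<^sup>2"] by (simp add: mult.assoc)
  also have "\<dots> = (s\<^sup>2 - t\<^sup>2) * (\<Sum>k | k < n + 2 \<and> odd (n + 2 + k). (s * t) ^ (n + 2 - 1 - k) * ?T k)"
    unfolding sum IH by (simp only: distrib_left mult_ac add.commute)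
  finally show ?case by (simp only: mult.assoc)
qed

section \<open>Identification with the given functions\<close>

text \<open>
  Here \<open>1 - q ^ i / q ^ n\<close> and \<open>1 - q ^ (n - i)\<close> differ by the factor \<open>- q ^ i / q ^ n\<close>, and with
  plus signs by \<open>q ^ i / q ^ n\<close>; the quotient of the two shifted factorials
  keeps only the signs.
\<close>

lemma qpoch_reversed_quotient:
  assumes "k \<le> n"
  shows "A n * (qpoch (q powi (- int n)) q k / qpoch (- (q powi (- int n))) q k) = (- 1) ^ k * A (n - k)"
  using assms
proof (induction k)
  case 0
  show ?case by (simp add: qpoch_def)
next
  case (Suc k)
  define d where "d = n - Suc k"
  have d: "n - k = Suc d" using Suc.prems by (simp add: d_def)
  have inv: "q powi (- int n) * q ^ k = inverse (q ^ Suc d)"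
  proof -
    have "q ^ n = q ^ Suc d * q ^ k" using Suc.prems d by (simp only: flip: d power_add) simp
    then show ?thesis using q_nonzero by (simp add: power_int_minus)
  qed
  have "(1 - inverse (q ^ Suc d)) / (1 + inverse (q ^ Suc d))
      = (q ^ Suc d * (1 - inverse (q ^ Suc d))) / (q ^ Suc d * (1 + inverse (q ^ Suc d)))"
    using q_nonzero by (intro mult_divide_mult_cancel_left[symmetric]) simp
  also have "q ^ Suc d * (1 - inverse (q ^ Suc d)) = - (1 - q ^ Suc d)"
    using q_nonzero by (simp add: right_diff_distrib del: power_Suc)
  also have "q ^ Suc d * (1 + inverse (q ^ Suc d)) = 1 + q ^ Suc d"
    using q_nonzero by (simp add: distrib_left del: power_Suc)
  also have "- (1 - q ^ Suc d) / (1 + q ^ Suc d) = - ((1 - q ^ Suc d) / (1 + q ^ Suc d))"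
    by (rule minus_divide_left[symmetric])
  finally have quot: "(1 - inverse (q ^ Suc d)) / (1 + inverse (q ^ Suc d))
      = - ((1 - q ^ Suc d) / (1 + q ^ Suc d))" .
  have "A n * (qpoch (q powi (- int n)) q (Suc k) / qpoch (- (q powi (- int n))) q (Suc k))
     = A n * (qpoch (q powi (- int n)) q k / qpoch (- (q powi (- int n))) q k)
       * ((1 - inverse (q ^ Suc d)) / (1 + inverse (q ^ Suc d)))"
    using inv by (simp add: qpoch_def)
  also have "\<dots> = (- 1) ^ k * A (Suc d) * - ((1 - q ^ Suc d) / (1 + q ^ Suc d))"
    using Suc d quot by simp
  also have "\<dots> = (- 1) ^ Suc k * A d"
    using one_plus_q_power_nonzero[of "Suc d"] q_power_neq_1[of "Suc d"]
    unfolding A_Suc by (simp del: power_Suc add: power_Suc[of "-1"])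
  finally show ?case by (simp add: d_def)
qed

lemma qP_factor:
  assumes "k \<le> n"
  shows "A n * (qpochs [- q, q powi (- int n)] q k / qpochs [q, - (q powi (- int n))] q k * x ^ k)
    = A k * A (n - k) * (- x) ^ k"
proof -
  have "A n * (qpochs [- q, q powi (- int n)] q k / qpochs [q, - (q powi (- int n))] q k * x ^ k)
     = A k * (A n * (qpoch (q powi (- int n)) q k / qpoch (- (q powi (- int n))) q k)) * x ^ k"
    by (simp add: qpochs_def A_def mult_ac)
  also have "\<dots> = A k * ((- 1) ^ k * A (n - k)) * x ^ k"
    by (simp only: qpoch_reversed_quotient[OF assms])
  finally show ?thesis by (simp add: power_minus[of x])
qed

lemma qP_one_variable: "qP q n [x] = conv n (- x)"
proof -
  let ?F = "\<lambda>k. qpochs [- q, q powi (- int n)] q k / qpochs [q, - (q powi (- int n))] q k * x ^ k"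
  have lists: "{ks :: nat list. length ks = 1 \<and> set ks \<subseteq> {0..n}} = (\<lambda>k. [k]) ` {..n}"
    by (auto simp: length_Suc_conv)
  have pairs: "{(i :: nat, j). i < j \<and> j < 1} = {}" by auto
  have len: "length [x] = 1" "{..<1::nat} = {0}" by auto
  have "qP q n [x] = A n * (\<Sum>ks\<in>(\<lambda>k. [k]) ` {..n}. ?F (ks ! 0))"
    unfolding qP_def Let_def len lists pairs by (simp add: A_def)
  also have "\<dots> = (\<Sum>k\<le>n. A n * ?F k)"
    by (subst sum.reindex) (auto simp: inj_on_def sum_distrib_left)
  also have "\<dots> = conv n (- x)"
    unfolding conv_def by (intro sum.cong refl qP_factor) simp
  finally show ?thesis .
qed

lemma qP_two_variables: "qP q n [x, y] = weighted_conv n (- x) (- y)"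
proof -
  let ?F = "\<lambda>x k. qpochs [- q, q powi (- int n)] q k / qpochs [q, - (q powi (- int n))] q k * x ^ k"
  let ?w = "\<lambda>k l. (q ^ l - q ^ k) / (q ^ l + q ^ k)"
  have lists: "{ks :: nat list. length ks = 2 \<and> set ks \<subseteq> {0..n}} = (\<lambda>(k, l). [k, l]) ` ({..n} \<times> {..n})"
    by (auto simp: length_Suc_conv numeral_2_eq_2)
  have pairs: "{(i :: nat, j). i < j \<and> j < 2} = {(0, 1)}" by auto
  have len: "length [x, y] = 2" "{..<2::nat} = {0, 1}" by auto
  have "qP q n [x, y] = (A n)\<^sup>2 *
      (\<Sum>ks\<in>(\<lambda>(k, l). [k, l]) ` ({..n} \<times> {..n}). ?w (ks ! 0) (ks ! 1) * (?F x (ks ! 0) * ?F y (ks ! 1)))"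
    unfolding qP_def Let_def len lists pairs by (simp add: A_def power_divide)
  also have "\<dots> = (A n)\<^sup>2 * (\<Sum>k\<le>n. \<Sum>l\<le>n. ?w k l * (?F x k * ?F y l))"
    by (subst sum.reindex) (auto simp: inj_on_def sum.cartesian_product case_prod_beta)
  also have "\<dots> = (\<Sum>k\<le>n. \<Sum>l\<le>n. ?w k l * ((A n * ?F x k) * (A n * ?F y l)))"
    by (simp only: sum_distrib_left power2_eq_square mult_ac)
  also have "\<dots> = weighted_conv n (- x) (- y)"
    unfolding weighted_conv_def
  proof (intro sum.cong refl)
    fix k l assume "k \<in> {..n}" "l \<in> {..n}"
    then show "?w k l * ((A n * ?F x k) * (A n * ?F y l))
        = ?w k l * ((A k * A (n - k)) * (A l * A (n - l))) * (- x) ^ k * (- y) ^ l"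
      by (simp only: qP_factor atMost_iff) (simp only: mult_ac)
  qed
  finally show ?thesis .
qed

text \<open>
  The powers \<open>s ^ (n - 2k)\<close> run downwards while \<open>conv\<close> has ascending ones; the symmetry of the
  coefficients under \<open>k \<mapsto> n - k\<close> reconciles the two.
\<close>

lemma cpoly_eq_conv:
  assumes "s \<noteq> 0"
  shows "s ^ n * cpoly q n (s + inverse s) = conv n (s\<^sup>2) / A n"
proof -
  have pw: "s ^ n * s powi (int n - 2 * int k) = (s\<^sup>2) ^ (n - k)" if "k \<le> n" for k
  proof -
    have "s ^ n * s powi (int n - 2 * int k) = s powi (int n + (int n - 2 * int k))"
      using power_int_add[of s "int n" "int n - 2 * int k"] assms by simp
    also have "int n + (int n - 2 * int k) = int (2 * (n - k))" using that by simp
    finally show ?thesis by (simp only: power_int_of_nat power_mult)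
  qed
  have "s ^ n * cpoly q n (s + inverse s)
      = (\<Sum>k=0..n. A k * A (n - k) * (s ^ n * s powi (int n - 2 * int k))) / A n"
    unfolding cpoly_joukowski[OF assms]
    by (simp add: A_def sum_distrib_left sum_distrib_right sum_divide_distrib mult_ac)
  also have "(\<Sum>k=0..n. A k * A (n - k) * (s ^ n * s powi (int n - 2 * int k)))
      = (\<Sum>k=0..n. A k * A (n - k) * (s\<^sup>2) ^ (n - k))"
    by (intro sum.cong refl) (simp add: pw)
  also have "\<dots> = (\<Sum>k=0..n. A k * A (n - k) * (s\<^sup>2) ^ k)"
    by (subst sum.atLeastAtMost_rev) (auto intro!: sum.cong simp: mult_ac)
  finally show ?thesis by (simp add: conv_def atMost_atLeast0)
qed

lemma cpoly_norm_sq_eq: "cpoly_norm_sq q k = 1 / (A k * A (Suc k))"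
  by (simp add: cpoly_norm_sq_def A_def)

lemma K_tilde_eq_sum:
  assumes "s \<noteq> 0" "t \<noteq> 0"
  shows "s ^ m * t ^ m * K_tilde q (Suc m) (s + inverse s) (t + inverse t)
    = (\<Sum>k | k < Suc m \<and> odd (Suc m + k).
         (s * t) ^ (m - k) * (A (Suc k) / A k) * conv k (s\<^sup>2) * conv k (t\<^sup>2))"
proof -
  have set: "{k. k \<le> Suc m - 1 \<and> k mod 2 = (Suc m - 1) mod 2} = {k. k < Suc m \<and> odd (Suc m + k)}"
    by (auto simp: mod2_eq_if split: if_splits)
  show ?thesis
    unfolding K_tilde_def set sum_distrib_left
  proof (rule sum.cong[OF refl])
    fix k assume "k \<in> {k. k < Suc m \<and> odd (Suc m + k)}"
    then have pw: "u ^ m = u ^ (m - k) * u ^ k" for u :: complex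
      by (simp flip: power_add)
    let ?c = "\<lambda>u. cpoly q k (u + inverse u)"
    have "s ^ m * t ^ m * (?c s * ?c t / cpoly_norm_sq q k)
        = (s * t) ^ (m - k) * (A k * A (Suc k)) * (s ^ k * ?c s) * (t ^ k * ?c t)"
      unfolding cpoly_norm_sq_eq pw[of s] pw[of t] by (simp add: power_mult_distrib)
    also have "\<dots> = (s * t) ^ (m - k) * (A (Suc k) / A k) * conv k (s\<^sup>2) * conv k (t\<^sup>2)"
      unfolding cpoly_eq_conv[OF assms(1)] cpoly_eq_conv[OF assms(2)] by simp
    finally show "s ^ m * t ^ m * (?c s * ?c t / cpoly_norm_sq q k)
        = (s * t) ^ (m - k) * (A (Suc k) / A k) * conv k (s\<^sup>2) * conv k (t\<^sup>2)" .
  qed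
qed

end

theorem lemma5p1:
  fixes q :: complex and n :: nat
  assumes q_nonzero: "q \<noteq> 0"
    and q_not_root_of_unity: "\<And>k::nat. k \<ge> 1 \<Longrightarrow> q ^ k \<noteq> 1"
    and n_ge_1: "n \<ge> 1"
  shows "(\<forall>x y. x * y \<noteq> 1 \<longrightarrow>
            qP q n [x, y] = (1 - q ^ (n + 1)) / (1 + q ^ (n + 1)) *
              ((y * qP q (n + 1) [x] * qP q (n - 1) [y] - x * qP q (n - 1) [x] * qP q (n + 1) [y])
                / (1 - x * y)))
       \<and> (\<forall>x y sx sy. x \<noteq> 0 \<longrightarrow> y \<noteq> 0 \<longrightarrow> sx\<^sup>2 = - x \<longrightarrow> sy\<^sup>2 = - y \<longrightarrow>
            qP q n [x, y] = sx ^ (n - 1) * sy ^ (n - 1) * (y - x) *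
              K_tilde q n (sx + inverse sx) (sy + inverse sy))"
proof -
  interpret generic_base q
    using q_nonzero q_not_root_of_unity by unfold_locales
  obtain m where n: "n = Suc m" using n_ge_1 by (cases n) auto
  show ?thesis
  proof (intro conjI allI impI)
    fix x y :: complex
    assume "x * y \<noteq> 1"
    then have nz: "1 - x * y \<noteq> 0" by simp
    have "(1 - x * y) * qP q n [x, y] = (1 - q ^ (n + 1)) / (1 + q ^ (n + 1)) *
        (y * qP q (n + 1) [x] * qP q (n - 1) [y] - x * qP q (n - 1) [x] * qP q (n + 1) [y])"
      using weighted_conv_closed_form[of "- x" "- y" m]
      unfolding qP_one_variable qP_two_variables n
      by (simp add: mult_ac del: power_Suc)
    then show "qP q n [x, y] = (1 - q ^ (n + 1)) / (1 + q ^ (n + 1)) *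
        ((y * qP q (n + 1) [x] * qP q (n - 1) [y] - x * qP q (n - 1) [x] * qP q (n + 1) [y])
          / (1 - x * y))"
      by (simp only: times_divide_eq_right nonzero_eq_divide_eq[OF nz] mult.commute[of "1 - x * y"])
  next
    fix x y sx sy :: complex
    assume "x \<noteq> 0" "y \<noteq> 0" and sq: "sx\<^sup>2 = - x" "sy\<^sup>2 = - y"
    then have nz: "sx \<noteq> 0" "sy \<noteq> 0" by auto
    have "qP q n [x, y] = (y - x) * (\<Sum>k | k < Suc m \<and> odd (Suc m + k).
        (sx * sy) ^ (m - k) * (A (Suc k) / A k) * conv k (sx\<^sup>2) * conv k (sy\<^sup>2))"
      using weighted_conv_kernel_sum[of n sx sy] unfolding qP_two_variables n sq by simp
    also have "\<dots> = (y - x) * (sx ^ m * sy ^ m * K_tilde q (Suc m) (sx + inverse sx) (sy + inverse sy))"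
      unfolding K_tilde_eq_sum[OF nz] ..
    finally show "qP q n [x, y] = sx ^ (n - 1) * sy ^ (n - 1) * (y - x) *
        K_tilde q n (sx + inverse sx) (sy + inverse sy)"
      by (simp add: n mult_ac)
  qed
qed

end
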